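(* Let $n\ge 1$, let $\alpha$ be a unitary $n\times n$ matrix, and let $B_1,B_2\in\mathscr{S}_n(\mathbb{C}^+)$ be equivalent in the sense that $B_1(w)=RB_2(w)Q$ for all $w\in\mathbb{C}^+$, where $R,Q$ are fixed constant unitary $n\times n$ matrices. Then the pure-point parts of the associated Clark measures satisfy $$\mu^{B_1\alpha^*}(\{s\})=R\,\mu^{B_2(Q\alpha^*R)}(\{s\})\,R^*\qquad\text{for all } s\in\mathbb{R}.$$
   Context: $\mathbb{C}^+$ is the open upper half-plane, $\mathbb{D}$ the open unit disk, $\mathbb{T}$ the unit circle. For an open set $X\subset\mathbb{C}$, $\mathscr{S}_n(X)$ denotes the set of contractive $n\times n$ matrix-valued analytic functions on $X$. The Cayley transform is $\gamma(w)=\frac{w-i}{w+i}$, a bijection of $\mathbb{C}^+$ onto $\mathbb{D}$ extending to a bijection of $\mathbb{R}$ onto $\mathbb{T}\setminus\{1\}$. For $B\in\mathscr{S}_n(\mathbb{C}^+)$ and a unitary matrix $\beta$, let $b\in\mathscr{S}_n(\mathbb{D})$ be defined by $B(w)=b(\gamma(w))$. It is understood that $I-b(\zeta)\beta^*$ is invertible for $\zeta\in\mathbb{D}$ whenever the Clark measure with parameter $\beta$ is considered: $\mu^{b\beta^*}$ is the unique nonnegative $n\times n$ matrix-valued Borel measure on $\mathbb{T}$ with $$\operatorname{Re}\big[(I-b(\zeta)\beta^* )^{-1}(I+b(\zeta)\beta^* )\big]=\int_{\mathbb{T}}\frac{1-|\zeta|^2}{|\lambda-\zeta|^2}\,\mu^{b\beta^*}(d\lambda),\quad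 \zeta\in\mathbb{D},$$ where $\operatorname{Re}X=\frac12(X+X^* )$. The Clark measure on the line is normalized here by $$\mu^{B\beta^*}(\Omega)=\int_\Omega\frac{1}{\pi(1+t^2)}\,(\mu^{b\beta^*}\circ\gamma)(dt),\qquad \Omega\subseteq\mathbb{R}\ \text{Borel},$$ where $(\mu^{b\beta^*}\circ\gamma)(\Omega)=\mu^{b\beta^*}(\gamma(\Omega))$. The notation $\mu^{B_2(Q\alpha^*R)}$ means $\mu^{B_2\beta^*}$ with $\beta=R^*\alpha Q^*$, so that $\beta^*=Q\alpha^*R$. *)

theory Defs
  imports "HOL-Analysis.Analysis" "HOL-Library.Nonpos_Ints"
begin

definition ctransp :: "complex^'m^'n \<Rightarrow> complex^'n^'m" where
  "ctransp A = (\<chi> i j. cnj (A $ j $ i))"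

definition unitary :: "complex^'n^'n \<Rightarrow> bool" where
  "unitary U \<longleftrightarrow> U ** ctransp U = mat 1 \<and> ctransp U ** U = mat 1"

definition matrix_Re :: "complex^'n^'n \<Rightarrow> complex^'n^'n" where
  "matrix_Re A = (1/2) *\<^sub>R (A + ctransp A)"

definition quad_form :: "complex^'n^'n \<Rightarrow> complex^'n \<Rightarrow> complex" where
  "quad_form A v = (\<Sum>i\<in>UNIV. cnj (v $ i) * (A *v v) $ i)"

definition nonneg_matrix :: "complex^'n^'n \<Rightarrow> bool" where
  "nonneg_matrix A \<longleftrightarrow> (\<forall>v. quad_form A v \<in> \<real>\<^sub>\<ge>\<^sub>0)"

text \<open>The norm of \<open>complex^'n\<close> is the Euclidean norm, so \<open>onorm\<close> below is the spectral norm.\<close>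

definition schur_class :: "complex set \<Rightarrow> (complex \<Rightarrow> complex^'n^'n) set" where
  "schur_class X = {B. (\<forall>i j. (\<lambda>w. B w $ i $ j) holomorphic_on X) \<and>
                       (\<forall>w\<in>X. onorm (\<lambda>v. B w *v v) \<le> 1)}"

definition upper_half_plane :: "complex set" where
  "upper_half_plane = {w. Im w > 0}"

definition cayley :: "complex \<Rightarrow> complex" where
  "cayley w = (w - \<i>) / (w + \<i>)"

definition disk_version :: "(complex \<Rightarrow> complex^'n^'n) \<Rightarrow> complex \<Rightarrow> complex^'n^'n" where
  "disk_version B \<zeta> = B (inv_into upper_half_plane cayley \<zeta>)"

text \<open>
  A matrix-valued measure is a set function on the sigma-algebra of \<open>M\<close>; only \<open>space M\<close> and
  \<open>sets M\<close> are used, never the measure carried by \<open>M\<close>. Its values on sets outside \<open>sets M\<close>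
  are irrelevant. Countable additivity gives the value \<open>0\<close> on the empty set.
\<close>

definition nonneg_matrix_measure :: "'a measure \<Rightarrow> ('a set \<Rightarrow> complex^'n^'n) \<Rightarrow> bool" where
  "nonneg_matrix_measure M \<mu> \<longleftrightarrow>
     (\<forall>\<Omega>\<in>sets M. nonneg_matrix (\<mu> \<Omega>)) \<and>
     (\<forall>A. range A \<subseteq> sets M \<longrightarrow> disjoint_family A \<longrightarrow> (\<lambda>k::nat. \<mu> (A k)) sums \<mu> (\<Union>k. A k))"

definition quad_measure ::
    "'a measure \<Rightarrow> ('a set \<Rightarrow> complex^'n^'n) \<Rightarrow> complex^'n \<Rightarrow> 'a measure" where
  "quad_measure M \<mu> v = measure_of (space M) (sets M) (\<lambda>\<Omega>. ennreal (Re (quad_form (\<mu> \<Omega>) v)))"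

text \<open>
  Integral of a scalar function against a nonnegative matrix-valued measure, in the weak sense:
  \<open>v\<^sup>* (\<integral> f d\<mu>) v = \<integral> f d(v\<^sup>* \<mu> v)\<close> for all vectors \<open>v\<close>. By polarization
  this determines the matrix (\<open>has_matrix_integral_unique\<close>) and amounts to integrating entrywise.
\<close>

definition has_matrix_integral ::
    "'a measure \<Rightarrow> ('a set \<Rightarrow> complex^'n^'n) \<Rightarrow> ('a \<Rightarrow> real) \<Rightarrow> complex^'n^'n \<Rightarrow> bool" where
  "has_matrix_integral M \<mu> f J \<longleftrightarrow>
     (\<forall>v. integrable (quad_measure M \<mu> v) f \<and>
          quad_form J v = complex_of_real (\<integral>x. f x \<partial>quad_measure M \<mu> v))"

definition circle_borel :: "complex measure" where
  "circle_borel = restrict_space borel (sphere 0 1)"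

text \<open>
  \<open>is_circle_clark_measure b \<beta> \<mu>\<close>: the set function \<open>\<mu>\<close> is the Clark measure of the disk
  function \<open>b\<close> with parameter \<open>\<beta>\<close>, i.e. of \<open>b \<beta>\<^sup>*\<close>.
\<close>

definition is_circle_clark_measure ::
    "(complex \<Rightarrow> complex^'n^'n) \<Rightarrow> complex^'n^'n \<Rightarrow> (complex set \<Rightarrow> complex^'n^'n) \<Rightarrow> bool" where
  "is_circle_clark_measure b \<beta> \<mu> \<longleftrightarrow>
     nonneg_matrix_measure circle_borel \<mu> \<and>
     (\<forall>\<zeta>\<in>ball 0 1.
        invertible (mat 1 - b \<zeta> ** ctransp \<beta>) \<and>
        has_matrix_integral circle_borel \<mu> (\<lambda>z. (1 - (norm \<zeta>)\<^sup>2) / (norm (z - \<zeta>))\<^sup>2)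
          (matrix_Re (matrix_inv (mat 1 - b \<zeta> ** ctransp \<beta>) ** (mat 1 + b \<zeta> ** ctransp \<beta>))))"

definition cayley_pullback :: "(complex set \<Rightarrow> complex^'n^'n) \<Rightarrow> real set \<Rightarrow> complex^'n^'n" where
  "cayley_pullback \<mu> \<Omega> = \<mu> ((\<lambda>t. cayley (complex_of_real t)) ` \<Omega>)"

definition is_line_clark_measure ::
    "(complex \<Rightarrow> complex^'n^'n) \<Rightarrow> complex^'n^'n \<Rightarrow> (real set \<Rightarrow> complex^'n^'n) \<Rightarrow> bool" where
  "is_line_clark_measure B \<beta> \<nu> \<longleftrightarrow>
     (\<exists>\<mu>. is_circle_clark_measure (disk_version B) \<beta> \<mu> \<and>
          (\<forall>\<Omega>\<in>sets borel.
             has_matrix_integral borel (cayley_pullback \<mu>)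
               (\<lambda>t. indicator \<Omega> t * (1 / (pi * (1 + t\<^sup>2)))) (\<nu> \<Omega>)))"

lemma cayley_bij_betw: "bij_betw cayley upper_half_plane (ball 0 1)"
proof (rule bij_betw_byWitness[where f' = "\<lambda>z. \<i> * (1 + z) / (1 - z)"])
  have nz: "w + \<i> \<noteq> 0" if "Im w > 0" for w
    using that by (auto simp: complex_eq_iff)
  show "\<forall>w\<in>upper_half_plane. \<i> * (1 + cayley w) / (1 - cayley w) = w"
  proof
    fix w assume "w \<in> upper_half_plane"
    then have "w + \<i> \<noteq> 0" using nz by (simp add: upper_half_plane_def)
    then have "1 + cayley w = 2 * w / (w + \<i>)" "1 - cayley w = 2 * \<i> / (w + \<i>)"
      by (simp_all add: cayley_def field_simps)
    with \<open>w + \<i> \<noteq> 0\<close> show "\<i> * (1 + cayley w) / (1 - cayley w) = w" by simp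
  qed
  show "\<forall>z\<in>ball 0 1. cayley (\<i> * (1 + z) / (1 - z)) = z"
  proof
    fix z :: complex assume "z \<in> ball 0 1"
    then have "1 - z \<noteq> 0" by auto
    then have "\<i> * (1 + z) / (1 - z) - \<i> = 2 * \<i> * z / (1 - z)"
      "\<i> * (1 + z) / (1 - z) + \<i> = 2 * \<i> / (1 - z)"
      by (simp_all add: field_simps)
    with \<open>1 - z \<noteq> 0\<close> show "cayley (\<i> * (1 + z) / (1 - z)) = z" by (simp add: cayley_def)
  qed
  show "cayley ` upper_half_plane \<subseteq> ball 0 1"
  proof clarify
    fix w assume w: "w \<in> upper_half_plane"
    then have "(norm (w - \<i>))\<^sup>2 < (norm (w + \<i>))\<^sup>2"
      unfolding cmod_power2 by (simp add: upper_half_plane_def power2_eq_square algebra_simps)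
    then have "norm (w - \<i>) < norm (w + \<i>)" by (rule power_less_imp_less_base) simp
    moreover have "norm (w + \<i>) > 0" using w nz by (simp add: upper_half_plane_def)
    ultimately show "cayley w \<in> ball 0 1" by (simp add: cayley_def norm_divide)
  qed
  show "(\<lambda>z. \<i> * (1 + z) / (1 - z)) ` ball 0 1 \<subseteq> upper_half_plane"
  proof clarify
    fix z :: complex assume z: "z \<in> ball 0 1"
    then have "1 - z \<noteq> 0" by auto
    then have pos: "(norm (1 - z))\<^sup>2 > 0" by simp
    have "Im (\<i> * (1 + z) / (1 - z)) = (1 - (norm z)\<^sup>2) / (norm (1 - z))\<^sup>2"
      unfolding Im_divide cmod_power2 by (simp add: power2_eq_square algebra_simps)
    moreover have "(norm z)\<^sup>2 < 1" using z by (simp add: power_less_one_iff abs_square_less_1)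
    ultimately show "\<i> * (1 + z) / (1 - z) \<in> upper_half_plane"
      using pos by (simp add: upper_half_plane_def)
  qed
qed

lemma disk_version_cayley:
  assumes "w \<in> upper_half_plane"
  shows "disk_version B (cayley w) = B w"
  using cayley_bij_betw assms by (simp add: disk_version_def bij_betw_def inv_into_f_f)

lemma quad_form_alt: "quad_form A v = (\<Sum>i\<in>UNIV. \<Sum>j\<in>UNIV. cnj (v $ i) * A $ i $ j * v $ j)"
  by (simp add: quad_form_def matrix_vector_mult_def sum_distrib_left mult.assoc)

lemma quad_form_inject:
  assumes "\<And>v. quad_form A v = quad_form B v"
  shows "A = B"
proof -
  define D where "D = A - B"
  define S where "S x y = (\<Sum>i\<in>UNIV. \<Sum>j\<in>UNIV. cnj (x $ i) * D $ i $ j * y $ j)" for x y :: "complex^'a"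
  have S0: "S v v = 0" for v
    using assms[of v] unfolding S_def D_def quad_form_alt
    by (simp add: algebra_simps sum_subtractf)
  have add: "S (x + y) (x + y) = S x x + S x y + S y x + S y y" for x y
    unfolding S_def by (simp add: algebra_simps sum.distrib)
  have sc: "S x (c *s y) = c * S x y" "S (c *s y) x = cnj c * S y x" for c x y
    unfolding S_def by (simp_all add: sum_distrib_left mult_ac)
  have S: "S x y = 0" for x y
  proof -
    have "S x y + S y x = 0" using add[of x y] S0 by simp
    moreover have "\<i> * S x y - \<i> * S y x = 0"
      using add[of x "\<i> *s y"] S0 sc[where c = \<i> and x = x and y = y] by simp
    ultimately show ?thesis by (simp add: complex_eq_iff)
  qed
  have "D $ i $ j = S (axis i 1) (axis j 1)" for i j
    unfolding S_def axis_def
    by (simp add: if_distrib[of cnj] if_distrib[of "\<lambda>x. x * _"] if_distrib[of "\<lambda>x. _ * x"] cong: if_cong)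
  then have "D = 0" using S by (simp add: vec_eq_iff)
  then show ?thesis by (simp add: D_def)
qed

lemma has_matrix_integral_unique:
  assumes "has_matrix_integral M \<mu> f J" "has_matrix_integral M \<mu> f J'"
  shows "J = J'"
  using assms by (intro quad_form_inject) (simp add: has_matrix_integral_def)

lemma emeasure_quad_measure:
  assumes \<mu>: "nonneg_matrix_measure M \<mu>" and "\<Omega> \<in> sets M"
  shows "emeasure (quad_measure M \<mu> v) \<Omega> = ennreal (Re (quad_form (\<mu> \<Omega>) v))"
proof (rule emeasure_measure_of[OF quad_measure_def])
  have lin: "bounded_linear (\<lambda>A. Re (quad_form A v))"
    unfolding quad_form_alt
    by (intro bounded_linear_compose[OF bounded_linear_Re] bounded_linear_sum
        bounded_linear_compose[OF bounded_linear_mult_left] bounded_linear_compose[OF bounded_linear_mult_right]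
        bounded_linear_compose[OF bounded_linear_vec_nth] bounded_linear_vec_nth)
  have pos: "0 \<le> Re (quad_form (\<mu> A) v)" if "A \<in> sets M" for A
    proof -
    have "quad_form (\<mu> A) v \<in> \<real>\<^sub>\<ge>\<^sub>0"
      using \<mu> that by (simp add: nonneg_matrix_measure_def nonneg_matrix_def)
    then show ?thesis by (auto simp: nonneg_Reals_def)
  qed
  have sums: "(\<lambda>k. Re (quad_form (\<mu> (A k)) v)) sums Re (quad_form (\<mu> (\<Union>k. A k)) v)"
    if "range A \<subseteq> sets M" "disjoint_family A" for A :: "nat \<Rightarrow> _"
    using \<mu> that by (intro bounded_linear.sums[OF lin]) (auto simp: nonneg_matrix_measure_def)
  have "(\<lambda>k::nat. Re (quad_form (\<mu> {}) v)) sums Re (quad_form (\<mu> {}) v)"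
    using sums[of "\<lambda>_. {}"] by (simp add: disjoint_family_on_def)
  then have "Re (quad_form (\<mu> {}) v) = 0"
    using sums_summable summable_const_iff by blast
  then show "positive (sets (quad_measure M \<mu> v)) (\<lambda>\<Omega>. ennreal (Re (quad_form (\<mu> \<Omega>) v)))"
    by (simp add: positive_def)
  show "countably_additive (sets (quad_measure M \<mu> v)) (\<lambda>\<Omega>. ennreal (Re (quad_form (\<mu> \<Omega>) v)))"
  proof (rule countably_additiveI)
    fix A :: "nat \<Rightarrow> _"
    assume "range A \<subseteq> sets (quad_measure M \<mu> v)" "disjoint_family A"
    then have A: "range A \<subseteq> sets M" "disjoint_family A"
      by (simp_all add: quad_measure_def)
    then show "(\<Sum>k. ennreal (Re (quad_form (\<mu> (A k)) v))) = ennreal (Re (quad_form (\<mu> (\<Union>k. A k)) v))"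
      using pos sums[OF A] by (intro suminf_ennreal_eq) auto
  qed
qed (use assms sets.space_closed in \<open>auto simp: quad_measure_def\<close>)

end

theory Submission
  imports Defs
begin

text \<open>
  Conjugating \<open>I - b\<^sub>2 \<beta>\<^sup>*\<close> by \<open>R\<close> gives \<open>I - b\<^sub>1 \<alpha>\<^sup>*\<close>, so the Poisson integrals of the two Clark
  measures are conjugate under \<open>R\<close>. A point mass at \<open>z\<close> is the limit, as \<open>r\<close> increases to 1, of the
  Poisson integral at \<open>r z\<close> times \<open>(1 - r) / (1 + r)\<close>: the rescaled kernel is
  \<open>((1 - r) / |\<lambda> - r z|)\<^sup>2\<close>, which is at most 1 and tends to the indicator of \<open>z\<close>.
\<close>

section \<open>Adjoints and conjugation by a unitary matrix\<close>

lemma ctransp_ctransp [simp]: "ctransp (ctransp A) = A"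
  by (simp add: ctransp_def vec_eq_iff)

lemma ctransp_mult: "ctransp (A ** B) = ctransp B ** ctransp A"
  by (simp add: ctransp_def matrix_matrix_mult_def vec_eq_iff mult.commute)

lemma sum_cnj_matrix_vector_mult:
  "(\<Sum>i\<in>UNIV. cnj (v $ i) * (A *v w) $ i) = (\<Sum>j\<in>UNIV. cnj ((ctransp A *v v) $ j) * w $ j)"
  unfolding matrix_vector_mult_def ctransp_def
  by (simp add: sum_distrib_left sum_distrib_right, subst sum.swap) (simp add: mult_ac)

text \<open>Trades conjugation of the matrix for a change of vector. Together with
  \<open>quad_form_inject\<close> this reduces a matrix identity up to conjugation to scalar
  identities between the forms at \<open>v\<close> and at \<open>ctransp R *v v\<close>.\<close>

lemma quad_form_conj: "quad_form (R ** A ** ctransp R) v = quad_form A (ctransp R *v v)"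
proof -
  have "(R ** A ** ctransp R) *v v = R *v (A *v (ctransp R *v v))"
    by (simp add: matrix_vector_mul_assoc matrix_mul_assoc)
  then show ?thesis
    by (simp add: quad_form_def sum_cnj_matrix_vector_mult)
qed

lemma matrix_add_rdistrib: "(A + B) ** C = A ** C + B ** C"
  by (simp add: matrix_matrix_mult_def vec_eq_iff sum.distrib distrib_right)

lemma matrix_diff_ldistrib:
  fixes A :: "'a::ring_1^'n^'m"
  shows "A ** (B - C) = A ** B - A ** C"
  by (simp add: matrix_matrix_mult_def vec_eq_iff sum_subtractf right_diff_distrib)

lemma matrix_diff_rdistrib:
  fixes A :: "'a::ring_1^'n^'m"
  shows "(A - B) ** C = A ** C - B ** C"
  by (simp add: matrix_matrix_mult_def vec_eq_iff sum_subtractf left_diff_distrib)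

lemma matrix_Re_conj: "matrix_Re (R ** A ** ctransp R) = R ** matrix_Re A ** ctransp R"
proof -
  have "ctransp (R ** A ** ctransp R) = R ** ctransp A ** ctransp R"
    by (simp add: ctransp_mult matrix_mul_assoc)
  then show ?thesis
    by (simp add: matrix_Re_def matrix_add_ldistrib matrix_add_rdistrib
        matrix_scalar_ac scalar_matrix_assoc scaleR_add_right)
qed

lemma
  assumes "invertible A"
  shows matrix_inv_right: "A ** matrix_inv A = mat 1"
    and matrix_inv_left: "matrix_inv A ** A = mat 1"
  using someI_ex[OF assms[unfolded invertible_def]] by (simp_all add: matrix_inv_def)

lemma matrix_inv_unique:
  assumes "A ** B = mat 1" and "B ** A = mat 1"
  shows "matrix_inv A = B"
proof -
  have "invertible A" using assms by (auto simp: invertible_def)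
  then show ?thesis
    by (metis assms(1) matrix_inv_left matrix_mul_assoc matrix_mul_lid matrix_mul_rid)
qed

text \<open>The inner factor \<open>ctransp U ** U\<close> cancels, so conjugation by
  \<open>U\<close> is multiplicative; compatibility with inverses follows from this.\<close>

lemma unitary_conj_mult:
  assumes "unitary U"
  shows "U ** X ** ctransp U ** (U ** Y ** ctransp U) = U ** (X ** Y) ** ctransp U"
  using assms unfolding unitary_def by (metis matrix_mul_assoc matrix_mul_rid)

lemma matrix_inv_conj:
  fixes A U :: "complex^'n^'n"
  assumes U: "unitary U" and A: "invertible A"
  shows "matrix_inv (U ** A ** ctransp U) = U ** matrix_inv A ** ctransp U"
proof (rule matrix_inv_unique)
  show "U ** A ** ctransp U ** (U ** matrix_inv A ** ctransp U) = mat 1"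
    using U A by (simp add: unitary_conj_mult unitary_def matrix_inv_right)
  show "U ** matrix_inv A ** ctransp U ** (U ** A ** ctransp U) = mat 1"
    using U A by (simp add: unitary_conj_mult unitary_def matrix_inv_left)
qed

text \<open>Since \<open>U ** ctransp U = mat 1\<close>, the identity matrix is its own conjugate,
  so both factors are conjugates of the corresponding factors for \<open>A\<close>. Conjugation then
  passes through the inverse, the product and the real part in turn.\<close>

lemma matrix_Re_cayley_conj:
  fixes A U :: "complex^'n^'n"
  assumes U: "unitary U" and A: "invertible (mat 1 - A)"
  shows "matrix_Re (matrix_inv (mat 1 - U ** A ** ctransp U) ** (mat 1 + U ** A ** ctransp U)) =
    U ** matrix_Re (matrix_inv (mat 1 - A) ** (mat 1 + A)) ** ctransp U"
proof -
  have eqs: "mat 1 - U ** A ** ctransp U = U ** (mat 1 - A) ** ctransp U"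
       "mat 1 + U ** A ** ctransp U = U ** (mat 1 + A) ** ctransp U"
    using U by (simp_all add: unitary_def matrix_add_ldistrib matrix_add_rdistrib
        matrix_diff_ldistrib matrix_diff_rdistrib)
  show ?thesis
    by (simp add: eqs matrix_inv_conj[OF U A] unitary_conj_mult[OF U] matrix_Re_conj)
qed

section \<open>Scalar measures of a matrix measure, and point masses on the circle\<close>

lemma measure_quad_measure:
  assumes "nonneg_matrix_measure M \<mu>" and "\<Omega> \<in> sets M"
  shows "measure (quad_measure M \<mu> v) \<Omega> = Re (quad_form (\<mu> \<Omega>) v)"
proof -
  have "quad_form (\<mu> \<Omega>) v \<in> \<real>\<^sub>\<ge>\<^sub>0"
    using assms by (simp add: nonneg_matrix_measure_def nonneg_matrix_def)
  \<comment> \<open>\<open>ennreal\<close> truncates negative reals to 0, so the sign is what lets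
    \<open>measure\<close> return the real number itself.\<close>
  then have "0 \<le> Re (quad_form (\<mu> \<Omega>) v)" by (auto simp: nonneg_Reals_def)
  then show ?thesis by (simp add: measure_def emeasure_quad_measure[OF assms])
qed

lemma space_quad_measure [simp]: "space (quad_measure M \<mu> v) = space M"
  and sets_quad_measure [simp, measurable_cong]: "sets (quad_measure M \<mu> v) = sets M"
  by (simp_all add: quad_measure_def)

lemma finite_measure_quad_measure:
  assumes "nonneg_matrix_measure M \<mu>"
  shows "finite_measure (quad_measure M \<mu> v)"
  by (rule finite_measureI) (simp add: emeasure_quad_measure[OF assms])

lemma space_circle_borel [simp]: "space circle_borel = sphere 0 1"
  by (simp add: circle_borel_def space_restrict_space)

lemma sets_circle_borel_iff: "A \<in> sets circle_borel \<longleftrightarrow> A \<in> sets borel \<and> A \<subseteq> sphere 0 1"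
  unfolding circle_borel_def by (subst sets_restrict_space_iff) auto

text \<open>\<open>P\<close> stands for the values of the Poisson integral. Keeping it abstract lets
  the lemma serve both Clark measures, and fixing the sequence \<open>r\<close> makes their limits
  run over the same radii.\<close>

lemma poisson_point_mass:
  fixes z :: complex
  assumes \<mu>: "nonneg_matrix_measure circle_borel \<mu>" and z: "norm z = 1"
    and P: "\<And>\<zeta>. \<zeta> \<in> ball 0 1 \<Longrightarrow>
      has_matrix_integral circle_borel \<mu> (\<lambda>x. (1 - (norm \<zeta>)\<^sup>2) / (norm (x - \<zeta>))\<^sup>2) (P \<zeta>)"
    and r: "r = (\<lambda>k::nat. real k / real (Suc k))"
  shows "(\<lambda>k. (1 - r k) / (1 + r k) * Re (quad_form (P (r k *\<^sub>R z)) v))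
    \<longlonglongrightarrow> Re (quad_form (\<mu> {z}) v)"
proof -
  define M where "M = quad_measure circle_borel \<mu> v"
  interpret finite_measure M
    unfolding M_def by (rule finite_measure_quad_measure[OF \<mu>])
  have zset: "{z} \<in> sets circle_borel" using z by (simp add: sets_circle_borel_iff)
  define f where "f k x = ((1 - r k) / norm (x - r k *\<^sub>R z))\<^sup>2" for k x
  have r01: "0 \<le> r k" "r k < 1" for k by (auto simp: r)
  have r1: "r \<longlonglongrightarrow> 1" unfolding r by (rule LIMSEQ_n_over_Suc_n)
  \<comment> \<open>As \<open>z\<close> has norm 1, the Poisson numerator factors as (1 - r)(1 + r);
    the prefactor cancels 1 + r and leaves a perfect square.\<close>
  have f_eq: "f k x = (1 - r k) / (1 + r k) * ((1 - (norm (r k *\<^sub>R z))\<^sup>2) / (norm (x - r k *\<^sub>R z))\<^sup>2)" for k x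
  proof -
    have "1 - (norm (r k *\<^sub>R z))\<^sup>2 = (1 - r k) * (1 + r k)"
      using z r01[of k] by (simp add: power2_eq_square algebra_simps)
    then show ?thesis
      using r01[of k] by (simp add: f_def power2_eq_square)
  qed
  have int: "integrable M (f k)"
    and val: "(\<integral>x. f k x \<partial>M) = (1 - r k) / (1 + r k) * Re (quad_form (P (r k *\<^sub>R z)) v)" for k
  proof -
    have "r k *\<^sub>R z \<in> ball 0 1" using z r01[of k] by simp
    from P[OF this, unfolded has_matrix_integral_def, rule_format, of v]
    have *: "integrable M (\<lambda>x. (1 - (norm (r k *\<^sub>R z))\<^sup>2) / (norm (x - r k *\<^sub>R z))\<^sup>2)"
      "Re (quad_form (P (r k *\<^sub>R z)) v) =
        (\<integral>x. (1 - (norm (r k *\<^sub>R z))\<^sup>2) / (norm (x - r k *\<^sub>R z))\<^sup>2 \<partial>M)"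
      unfolding M_def[symmetric] by simp_all
    show "integrable M (f k)"
      unfolding f_eq by (intro integrable_mult_right *(1))
    show "(\<integral>x. f k x \<partial>M) = (1 - r k) / (1 + r k) * Re (quad_form (P (r k *\<^sub>R z)) v)"
      unfolding f_eq *(2) by (rule integral_mult_right_zero)
  qed
  have le1: "f k x \<le> 1" if "norm x = 1" for k x
  proof -
    \<comment> \<open>Reverse triangle inequality, with \<open>x\<close> and \<open>z\<close> both
      on the circle.\<close>
    have "1 - r k \<le> norm (x - r k *\<^sub>R z)"
      using norm_triangle_ineq2[of x "r k *\<^sub>R z"] that z r01[of k] by simp
    then have "(1 - r k) / norm (x - r k *\<^sub>R z) \<le> 1"
      using r01[of k] by (simp add: divide_le_eq_1)
    then show ?thesis
      unfolding f_def using r01[of k] by (intro power_le_one) auto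
  qed
  have lim: "(\<lambda>k. f k x) \<longlonglongrightarrow> indicator {z} x" for x
  proof (cases "x = z")
    case True
    \<comment> \<open>At \<open>z\<close> numerator and denominator coincide, and
      \<open>r k < 1\<close> keeps the quotient from being 0/0.\<close>
    have "z - r k *\<^sub>R z = (1 - r k) *\<^sub>R z" for k by (simp add: algebra_simps)
    then have "f k z = 1" for k using r01[of k] z by (simp add: f_def)
    with True show ?thesis by simp
  next
    case False
    \<comment> \<open>Away from \<open>z\<close> the denominator has the nonzero limit
      \<open>norm (x - z)\<close>, while the numerator tends to 0.\<close>
    have "(\<lambda>k. f k x) \<longlonglongrightarrow> ((1 - 1) / norm (x - 1 *\<^sub>R z))\<^sup>2"
      unfolding f_def using False by (intro tendsto_intros r1) auto
    with False show ?thesis by simp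
  qed
  have "(\<lambda>k. \<integral>x. f k x \<partial>M) \<longlonglongrightarrow> (\<integral>x. indicator {z} x \<partial>M)"
  \<comment> \<open>The constant majorant 1 is integrable because \<open>M\<close> is a finite
    measure.\<close>
  proof (rule integral_dominated_convergence[where w = "\<lambda>_. 1"])
    show "(indicator {z} :: _ \<Rightarrow> real) \<in> borel_measurable M"
      using zset by (intro borel_measurable_indicator) (simp add: M_def)
    show "f k \<in> borel_measurable M" for k using int by blast
    show "AE x in M. (\<lambda>k. f k x) \<longlonglongrightarrow> indicator {z} x" using lim by simp
    show "AE x in M. norm (f k x) \<le> 1" for k
      using le1 by (intro AE_I2) (auto simp: M_def f_def)
  qed simp
  moreover have "(\<integral>x. indicator {z} x \<partial>M) = Re (quad_form (\<mu> {z}) v)"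
    using zset measure_quad_measure[OF \<mu> zset, of v] by (simp add: M_def z)
  ultimately show ?thesis by (simp add: val)
qed

section \<open>The Cayley transform on the real line\<close>

lemma cayley_real:
  fixes t :: real
  shows "norm (cayley t) = 1" "cayley t \<noteq> 1" "\<i> * (1 + cayley t) / (1 - cayley t) = t"
proof -
  have nz: "complex_of_real t + \<i> \<noteq> 0" by (simp add: complex_eq_iff)
  then have eqs: "1 + cayley t = 2 * t / (t + \<i>)" "1 - cayley t = 2 * \<i> / (t + \<i>)"
    by (simp_all add: cayley_def field_simps)
  have "norm (complex_of_real t - \<i>) = norm (complex_of_real t + \<i>)"
    by (simp add: cmod_def)
  then show "norm (cayley t) = 1"
    using nz by (simp add: cayley_def norm_divide)
  show "cayley t \<noteq> 1" using eqs(2) nz by auto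
  show "\<i> * (1 + cayley t) / (1 - cayley t) = t" using nz by (simp add: eqs)
qed

lemma inj_cayley_real: "inj (\<lambda>t::real. cayley t)"
  by (rule injI) (metis cayley_real(3) of_real_eq_iff)

text \<open>A forward image of a Borel set is awkward to measure directly, so it is rewritten as a
  preimage under the explicit inverse \<open>g\<close>: the points where \<open>g\<close> is real
  with value in \<Omega>. Reality of \<open>g z\<close> encodes that \<open>z\<close> lies on the
  circle.\<close>

lemma cayley_image_sets:
  assumes "\<Omega> \<in> sets (borel :: real measure)"
  shows "(\<lambda>t. cayley (complex_of_real t)) ` \<Omega> \<in> sets circle_borel"
proof -
  define g :: "complex \<Rightarrow> complex" where "g z = \<i> * (1 + z) / (1 - z)" for z
  have [measurable]: "g \<in> borel_measurable borel" unfolding g_def by measurable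
  \<comment> \<open>The point 1 must be excluded by hand: division by zero gives
    \<open>g 1 = 0\<close>, so 1 would otherwise be counted whenever 0 is in \<Omega>.\<close>
  have "(\<lambda>t. cayley (complex_of_real t)) ` \<Omega> =
    {z. z \<noteq> 1 \<and> Im (g z) = 0 \<and> Re (g z) \<in> \<Omega>}"
  proof safe
    fix t :: real assume "t \<in> \<Omega>"
    then show "cayley t = 1 \<Longrightarrow> False" "Im (g (cayley t)) = 0" "Re (g (cayley t)) \<in> \<Omega>"
      using cayley_real[of t] by (simp_all add: g_def)
  next
    fix z assume z: "z \<noteq> 1" "Im (g z) = 0" "Re (g z) \<in> \<Omega>"
    have "g z - \<i> = 2 * \<i> * z / (1 - z)" "g z + \<i> = 2 * \<i> / (1 - z)"
      using z(1) by (simp_all add: g_def field_simps)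
    then have "cayley (g z) = z" using z(1) by (simp add: cayley_def)
    moreover have "g z = complex_of_real (Re (g z))" using z(2) by (simp add: complex_eq_iff)
    ultimately show "z \<in> (\<lambda>t. cayley (complex_of_real t)) ` \<Omega>" using z(3) by (metis image_eqI)
  qed
  also have "\<dots> \<in> sets borel" using assms by measurable
  finally show ?thesis
    using cayley_real(1) by (auto simp: sets_circle_borel_iff)
qed

section \<open>From the circle to Clark measures on the line\<close>

lemma nonneg_matrix_measure_cayley_pullback:
  assumes "nonneg_matrix_measure circle_borel \<mu>"
  shows "nonneg_matrix_measure borel (cayley_pullback \<mu>)"
  unfolding nonneg_matrix_measure_def
proof (intro conjI ballI allI impI)
  let ?c = "\<lambda>t. cayley (complex_of_real t)"
  show "nonneg_matrix (cayley_pullback \<mu> \<Omega>)" if "\<Omega> \<in> sets borel" for \<Omega>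
    using assms cayley_image_sets[OF that]
    by (simp add: nonneg_matrix_measure_def cayley_pullback_def)
  fix A :: "nat \<Rightarrow> real set"
  assume A: "range A \<subseteq> sets borel" "disjoint_family A"
  then have "range (\<lambda>k. ?c ` A k) \<subseteq> sets circle_borel"
    using cayley_image_sets by auto
  moreover have "disjoint_family (\<lambda>k. ?c ` A k)"
    using A(2) by (simp add: disjoint_family_on_def image_Int[OF inj_cayley_real, symmetric])
  ultimately show "(\<lambda>k. cayley_pullback \<mu> (A k)) sums cayley_pullback \<mu> (\<Union>k. A k)"
    using assms by (simp add: nonneg_matrix_measure_def cayley_pullback_def image_UN)
qed

text \<open>On a singleton the density 1/(pi (1 + t^2)) is constant, so the integral is its value at
  \<open>s\<close> times the circle mass at the Cayley image of \<open>s\<close>. One circle measure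
  serves all \<open>s\<close> and \<open>v\<close>.\<close>

lemma line_clark_point_mass:
  assumes "is_line_clark_measure B \<beta> \<nu>"
  obtains \<mu> where "is_circle_clark_measure (disk_version B) \<beta> \<mu>"
    "\<And>s v. quad_form (\<nu> {s}) v = Re (quad_form (\<mu> {cayley (complex_of_real s)}) v) / (pi * (1 + s\<^sup>2))"
proof -
  obtain \<mu> where \<mu>: "is_circle_clark_measure (disk_version B) \<beta> \<mu>"
    and \<nu>: "\<And>\<Omega>. \<Omega> \<in> sets borel \<Longrightarrow> has_matrix_integral borel (cayley_pullback \<mu>)
               (\<lambda>t. indicator \<Omega> t * (1 / (pi * (1 + t\<^sup>2)))) (\<nu> \<Omega>)"
    using assms by (auto simp: is_line_clark_measure_def)
  have pb: "nonneg_matrix_measure borel (cayley_pullback \<mu>)"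
    using \<mu> by (intro nonneg_matrix_measure_cayley_pullback) (simp add: is_circle_clark_measure_def)
  have "quad_form (\<nu> {s}) v = Re (quad_form (\<mu> {cayley (complex_of_real s)}) v) / (pi * (1 + s\<^sup>2))" for s v
  proof -
    let ?M = "quad_measure borel (cayley_pullback \<mu>) v"
    have "quad_form (\<nu> {s}) v = (\<integral>t. indicator {s} t * (1 / (pi * (1 + t\<^sup>2))) \<partial>?M)"
      using \<nu>[of "{s}"] by (simp add: has_matrix_integral_def)
    \<comment> \<open>The indicator vanishes off \<open>s\<close>, so the weight may be frozen at
      \<open>s\<close> and pulled out of the integral.\<close>
    also have "(\<lambda>t. indicator {s} t * (1 / (pi * (1 + t\<^sup>2)))) =
        (\<lambda>t. indicator {s} t * (1 / (pi * (1 + s\<^sup>2))))"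
      by (auto simp: indicator_def)
    also have "(\<integral>t. indicator {s} t * (1 / (pi * (1 + s\<^sup>2))) \<partial>?M) =
        measure ?M {s} * (1 / (pi * (1 + s\<^sup>2)))"
      by simp
    also have "measure ?M {s} = Re (quad_form (\<mu> {cayley (complex_of_real s)}) v)"
      by (simp add: measure_quad_measure[OF pb] cayley_pullback_def)
    finally show ?thesis by simp
  qed
  with \<mu> that show thesis by blast
qed

theorem theorem8:
  fixes \<alpha> R Q :: "complex^'n^'n"
    and B\<^sub>1 B\<^sub>2 :: "complex \<Rightarrow> complex^'n^'n"
    and \<mu>\<^sub>1 \<mu>\<^sub>2 :: "real set \<Rightarrow> complex^'n^'n"
  assumes "unitary \<alpha>" and "unitary R" and "unitary Q"
    and "B\<^sub>1 \<in> schur_class upper_half_plane"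
    and "B\<^sub>2 \<in> schur_class upper_half_plane"
    and "\<And>w. w \<in> upper_half_plane \<Longrightarrow> B\<^sub>1 w = R ** B\<^sub>2 w ** Q"
    and "is_line_clark_measure B\<^sub>1 \<alpha> \<mu>\<^sub>1"
    and "is_line_clark_measure B\<^sub>2 (ctransp R ** \<alpha> ** ctransp Q) \<mu>\<^sub>2"
  shows "\<forall>s::real. \<mu>\<^sub>1 {s} = R ** \<mu>\<^sub>2 {s} ** ctransp R"
proof
  fix s :: real
  let ?\<beta> = "ctransp R ** \<alpha> ** ctransp Q"
  let ?z = "cayley (complex_of_real s)"
  \<comment> \<open>\<open>H b \<beta> \<zeta>\<close> is the value at \<zeta> of the Poisson
    integral of the Clark measure of \<open>b\<close> with parameter \<beta>.\<close>
  define H where "H b \<beta> \<zeta> = matrix_Re (matrix_inv (mat 1 - b \<zeta> ** ctransp \<beta>) ** (mat 1 + b \<zeta> ** ctransp \<beta>))"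
    for b :: "complex \<Rightarrow> complex^'n^'n" and \<beta> \<zeta>
  obtain m\<^sub>1 where m1: "is_circle_clark_measure (disk_version B\<^sub>1) \<alpha> m\<^sub>1"
    and q1: "\<And>s v. quad_form (\<mu>\<^sub>1 {s}) v = Re (quad_form (m\<^sub>1 {cayley (complex_of_real s)}) v) / (pi * (1 + s\<^sup>2))"
    using line_clark_point_mass[OF assms(7)] by blast
  obtain m\<^sub>2 where m2: "is_circle_clark_measure (disk_version B\<^sub>2) ?\<beta> m\<^sub>2"
    and q2: "\<And>s v. quad_form (\<mu>\<^sub>2 {s}) v = Re (quad_form (m\<^sub>2 {cayley (complex_of_real s)}) v) / (pi * (1 + s\<^sup>2))"
    using line_clark_point_mass[OF assms(8)] by blast
  have H: "H (disk_version B\<^sub>1) \<alpha> \<zeta> = R ** H (disk_version B\<^sub>2) ?\<beta> \<zeta> ** ctransp R"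
    if \<zeta>: "\<zeta> \<in> ball 0 1" for \<zeta>
  proof -
    have "inv_into upper_half_plane cayley \<zeta> \<in> upper_half_plane"
      using cayley_bij_betw \<zeta> by (metis bij_betw_imp_surj_on inv_into_into)
    then have "disk_version B\<^sub>1 \<zeta> = R ** disk_version B\<^sub>2 \<zeta> ** Q"
      using assms(6) by (simp add: disk_version_def)
    moreover have "ctransp ?\<beta> = Q ** ctransp \<alpha> ** R"
      by (simp add: ctransp_mult matrix_mul_assoc)
    moreover have "R ** ctransp R = mat 1" using assms(2) by (simp add: unitary_def)
    \<comment> \<open>Insert \<open>R ** ctransp R = mat 1\<close> on the right of
      \<open>R ** b ** Q ** ctransp \<alpha>\<close>, where \<open>b\<close> is the value of the
      second disk function; the middle then regroups to \<open>b ** ctransp ?\<beta>\<close>. This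
      is what dictates the form of the second parameter.\<close>
    ultimately have "disk_version B\<^sub>1 \<zeta> ** ctransp \<alpha> = R ** (disk_version B\<^sub>2 \<zeta> ** ctransp ?\<beta>) ** ctransp R"
      by (metis matrix_mul_assoc matrix_mul_rid)
    moreover have "invertible (mat 1 - disk_version B\<^sub>2 \<zeta> ** ctransp ?\<beta>)"
      using m2 \<zeta> by (simp add: is_circle_clark_measure_def)
    ultimately show ?thesis
      by (simp add: H_def matrix_Re_cayley_conj[OF assms(2)])
  qed
  \<comment> \<open>By \<open>H\<close> and \<open>quad_form_conj\<close> the two radial sequences
    agree term by term, one tested at \<open>v\<close> and the other at
    \<open>ctransp R *v v\<close>, so their limits, the point masses, agree.\<close>
  have "Re (quad_form (m\<^sub>1 {?z}) v) = Re (quad_form (m\<^sub>2 {?z}) (ctransp R *v v))" for v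
  proof (rule LIMSEQ_unique)
    define r where "r = (\<lambda>k::nat. real k / real (Suc k))"
    have r01: "0 \<le> r k" "r k < 1" for k by (auto simp: r_def)
    have "r k *\<^sub>R ?z \<in> ball 0 1" for k
      using r01[of k] by (simp add: cayley_real)
    note conj = H[OF this]
    show "(\<lambda>k. (1 - r k) / (1 + r k) * Re (quad_form (H (disk_version B\<^sub>1) \<alpha> (r k *\<^sub>R ?z)) v))
      \<longlonglongrightarrow> Re (quad_form (m\<^sub>1 {?z}) v)"
      by (rule poisson_point_mass[OF _ cayley_real(1) _ r_def])
         (use m1 in \<open>simp_all add: is_circle_clark_measure_def H_def\<close>)
    have "(\<lambda>k. (1 - r k) / (1 + r k) * Re (quad_form (H (disk_version B\<^sub>2) ?\<beta> (r k *\<^sub>R ?z)) (ctransp R *v v)))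
      \<longlonglongrightarrow> Re (quad_form (m\<^sub>2 {?z}) (ctransp R *v v))"
      by (rule poisson_point_mass[OF _ cayley_real(1) _ r_def])
         (use m2 in \<open>simp_all add: is_circle_clark_measure_def H_def\<close>)
    then show "(\<lambda>k. (1 - r k) / (1 + r k) * Re (quad_form (H (disk_version B\<^sub>1) \<alpha> (r k *\<^sub>R ?z)) v))
      \<longlonglongrightarrow> Re (quad_form (m\<^sub>2 {?z}) (ctransp R *v v))"
      by (simp add: conj quad_form_conj)
  qed
  then show "\<mu>\<^sub>1 {s} = R ** \<mu>\<^sub>2 {s} ** ctransp R"
    \<comment> \<open>Both line masses carry the same factor pi (1 + s^2), so equality of the circle
      forms for every \<open>v\<close> gives equality of the matrices.\<close>
    by (intro quad_form_inject) (simp add: q1 q2 quad_form_conj)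
qed

end
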